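(* Let $N\ge 3$ be an integer, $0<a<b$ and $A=\{x\in\mathbb{R}^N : a<|x|<b\}$. For $p>1$ let $u_p(x)=u_p(r)$, $r=|x|$, be the unique radially symmetric solution of $$-\Delta u=(N-2)^2\frac{u^p(x)}{|x|^{2(N-1)}}\ (x\in A),\qquad u(x)>0\ (x\in A),\qquad u(x)=0\ (x\in\partial A).$$ Define $\varepsilon_p>0$ by $p\,\varepsilon_p^2\,\|u_p\|_{L^\infty(A)}^{p-1}=1$ and define $$\tilde u_p(t)=\frac{p}{\|u_p\|_{L^\infty(A)}}\left\{u_p\left(\left(\varepsilon_p t+\frac{a^{2-N}+b^{2-N}}{2}\right)^{\frac{1}{2-N}}\right)-\|u_p\|_{L^\infty(A)}\right\},\qquad t\in I_p=\left(-\frac{a^{2-N}-b^{2-N}}{2\varepsilon_p},\ \frac{a^{2-N}-b^{2-N}}{2\varepsilon_p}\right).$$ Then, as $p\to\infty$, $\varepsilon_p\to 0$ and $$\tilde u_p(t)\to U(t)=\log\frac{4e^{\sqrt2\,t}}{(1+e^{\sqrt2\,t})^2}\quad\text{in } C^1_{loc}(\mathbb{R}).$$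
   Context: Let $N\ge 3$ be an integer, $0<a<b$ and $A=\{x\in\mathbb{R}^N : a<|x|<b\}$. For every $p>1$ the boundary value problem $$-\Delta u=(N-2)^2\frac{u^p(x)}{|x|^{2(N-1)}}\ (x\in A),\qquad u(x)>0\ (x\in A),\qquad u(x)=0\ (x\in\partial A)$$ has exactly one radially symmetric solution $u_p$ (solutions are understood in the classical sense, $u\in C^2(A)\cap C^0(\overline{A})$); it is identified with a function of $r=|x|\in[a,b]$. Convergence in $C^1_{loc}(\mathbb{R})$ means: for every compact $K\subset\mathbb{R}$, $K\subset I_p$ for all sufficiently large $p$, and $\tilde u_p\to U$, $\tilde u_p'\to U'$ uniformly on $K$. *)

theory Defs
  imports "HOL-Analysis.Analysis" "HOL-Probability.Essential_Supremum"
begin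

definition partial_deriv :: "'n \<Rightarrow> (real ^ 'n \<Rightarrow> real) \<Rightarrow> real ^ 'n \<Rightarrow> real" where
  "partial_deriv i f x = deriv (\<lambda>t. f (x + t *\<^sub>R axis i 1)) 0"

(* Intended for open S only: difference quotients may leave a non-open S. *)
definition C1_on :: "(real ^ 'n) set \<Rightarrow> (real ^ 'n \<Rightarrow> real) \<Rightarrow> bool" where
  "C1_on S f \<longleftrightarrow> continuous_on S f \<and>
     (\<forall>i. (\<forall>x\<in>S. (\<lambda>t. f (x + t *\<^sub>R axis i 1)) differentiable (at 0)) \<and>
          continuous_on S (partial_deriv i f))"

definition C2_on :: "(real ^ 'n) set \<Rightarrow> (real ^ 'n \<Rightarrow> real) \<Rightarrow> bool" where
  "C2_on S f \<longleftrightarrow> C1_on S f \<and> (\<forall>i. C1_on S (partial_deriv i f))"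

definition laplacian :: "(real ^ 'n \<Rightarrow> real) \<Rightarrow> real ^ 'n \<Rightarrow> real" where
  "laplacian f x = (\<Sum>i\<in>UNIV. partial_deriv i (partial_deriv i f) x)"

definition annulus :: "real \<Rightarrow> real \<Rightarrow> (real ^ 'n) set" where
  "annulus a b = {x. a < norm x \<and> norm x < b}"

definition radial_on :: "(real ^ 'n) set \<Rightarrow> (real ^ 'n \<Rightarrow> real) \<Rightarrow> bool" where
  "radial_on S u \<longleftrightarrow> (\<forall>x\<in>S. \<forall>y\<in>S. norm x = norm y \<longrightarrow> u x = u y)"

(* The function of r = |x| with which a radial u is identified; meaningful for those r
   such that u is constant on the sphere of radius r. *)
definition radial_profile :: "(real ^ 'n \<Rightarrow> real) \<Rightarrow> real \<Rightarrow> real" where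
  "radial_profile u r = (THE c. \<forall>x. norm x = r \<longrightarrow> u x = c)"

(* The domain of a solution is the closed annulus; its values elsewhere are irrelevant. *)
definition radial_solution ::
  "nat \<Rightarrow> real \<Rightarrow> real \<Rightarrow> real \<Rightarrow> (real ^ 'n \<Rightarrow> real) \<Rightarrow> bool" where
  "radial_solution N a b p u \<longleftrightarrow>
     C2_on (annulus a b) u \<and> continuous_on (closure (annulus a b)) u \<and>
     (\<forall>x\<in>annulus a b.
        - laplacian u x = (real N - 2)\<^sup>2 * (u x powr p / norm x ^ (2 * (N - 1)))) \<and>
     (\<forall>x\<in>annulus a b. u x > 0) \<and>
     (\<forall>x\<in>frontier (annulus a b). u x = 0) \<and>
     radial_on (closure (annulus a b)) u"

definition Linfty_norm :: "(real ^ 'n) set \<Rightarrow> (real ^ 'n \<Rightarrow> real) \<Rightarrow> real" where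
  "Linfty_norm S u = real_of_ereal (esssup (lebesgue_on S) (\<lambda>x. ereal \<bar>u x\<bar>))"

definition rescaled ::
  "nat \<Rightarrow> real \<Rightarrow> real \<Rightarrow> real \<Rightarrow> real \<Rightarrow> (real ^ 'n \<Rightarrow> real) \<Rightarrow> real \<Rightarrow> real" where
  "rescaled N a b p \<epsilon> u t =
     p / Linfty_norm (annulus a b) u *
       (radial_profile u
          ((\<epsilon> * t + (a powr (2 - real N) + b powr (2 - real N)) / 2) powr (1 / (2 - real N)))
        - Linfty_norm (annulus a b) u)"

definition rescaled_interval :: "nat \<Rightarrow> real \<Rightarrow> real \<Rightarrow> real \<Rightarrow> real set" where
  "rescaled_interval N a b \<epsilon> =
     {- ((a powr (2 - real N) - b powr (2 - real N)) / (2 * \<epsilon>)) <..<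
        (a powr (2 - real N) - b powr (2 - real N)) / (2 * \<epsilon>)}"

(* f p is only considered on I p. The C1 conditions ensure that deriv, which is total,
   denotes the actual derivative. *)
definition C1_loc_converges ::
  "(real \<Rightarrow> real \<Rightarrow> real) \<Rightarrow> (real \<Rightarrow> real set) \<Rightarrow> (real \<Rightarrow> real) \<Rightarrow> real filter \<Rightarrow> bool" where
  "C1_loc_converges f I g F \<longleftrightarrow>
     (\<forall>\<^sub>F p in F. f p C1_differentiable_on I p) \<and> g C1_differentiable_on UNIV \<and>
     (\<forall>K. compact K \<longrightarrow>
        (\<forall>\<^sub>F p in F. K \<subseteq> I p) \<and>
        uniform_limit K f g F \<and>
        uniform_limit K (\<lambda>p. deriv (f p)) (deriv g) F)"

end

theory Submission
  imports Defs
begin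

text \<open>
  The weight \<open>(N - 2)\<^sup>2 / r\<^bsup>2(N-1)\<^esup>\<close> is special: in the variable \<open>s = r\<^bsup>2-N\<^esup>\<close> a radial solution
  becomes a positive solution \<open>v\<close> of \<open>- v'' = v\<^sup>p\<close> on an interval, with zero boundary values
  (\<open>radial_laplacian\<close>, \<open>radial_solution_lane_emden_profile\<close>). Uniqueness for the initial value
  problem makes \<open>v\<close> symmetric, so its maximum \<open>M\<close>, which is the supremum norm of the solution, sits
  at the midpoint of the interval (\<open>lane_emden_profile_max_at_midpoint\<close>). The mean value theorem
  yields \<open>M\<^bsup>p-1\<^esup> \<ge> 1 / (\<beta> - \<alpha>)\<^sup>2\<close>, where \<open>\<alpha>\<close> and \<open>\<beta>\<close> are the end points, and therefore
  \<open>\<epsilon> \<le> (\<beta> - \<alpha>) / sqrt p\<close>, which tends to 0 (\<open>lane_emden_rescaling_bound\<close>).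

  The rescaled function \<open>w\<close> satisfies \<open>- w'' = (1 + w / p)\<^sup>p\<close> with \<open>w 0 = w' 0 = 0\<close>, whereas the limit
  \<open>U\<close> satisfies \<open>- U'' = exp U\<close> with the same initial values. As \<open>\<bar>w''\<bar> \<le> 1\<close>, the functions \<open>w\<close>
  are bounded on compact sets independently of \<open>p\<close>, the two equations differ there by \<open>O(1 / p)\<close>,
  and Gronwall's inequality bounds \<open>w - U\<close> and \<open>w' - U'\<close> by a multiple of \<open>1 / p\<close>
  (\<open>rescaled_lane_emden_profile_estimate\<close>). This is stronger than locally uniform convergence.
\<close>

section \<open>Elementary estimates\<close>

text \<open>
  Uniqueness and stability for second-order initial value problems in one stroke. The energy
  \<open>E = z\<^sup>2 + z'\<^sup>2\<close> satisfies \<open>\<bar>E'\<bar> \<le> (K + 2) E + \<delta>\<^sup>2\<close>, because every product that occurs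
  in \<open>E' = 2 z z' + 2 z' z''\<close> is dominated by a sum of squares. With \<open>\<delta> = 0\<close> it forces
  \<open>z = 0\<close>, and with small \<open>\<delta>\<close> it bounds \<open>z\<close> and \<open>z'\<close> simultaneously.
\<close>
lemma second_order_gronwall:
  fixes z z' z'' :: "real \<Rightarrow> real"
  assumes z: "\<And>s. \<bar>s\<bar> \<le> T \<Longrightarrow> (z has_real_derivative z' s) (at s)"
    and z': "\<And>s. \<bar>s\<bar> \<le> T \<Longrightarrow> (z' has_real_derivative z'' s) (at s)"
    and bound: "\<And>s. \<bar>s\<bar> \<le> T \<Longrightarrow> \<bar>z'' s\<bar> \<le> K * \<bar>z s\<bar> + \<delta>"
    and "0 \<le> K" and "0 \<le> \<delta>" and "z 0 = 0" and "z' 0 = 0" and "\<bar>t\<bar> \<le> T"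
  shows "(z t)\<^sup>2 + (z' t)\<^sup>2 \<le> \<delta>\<^sup>2 * exp ((K + 2) * \<bar>t\<bar>)"
proof -
  have forward: "(y t)\<^sup>2 + (y' t)\<^sup>2 \<le> \<delta>\<^sup>2 * exp ((K + 2) * t)"
    if y: "\<And>s. \<bar>s\<bar> \<le> T \<Longrightarrow> (y has_real_derivative y' s) (at s)"
      and y': "\<And>s. \<bar>s\<bar> \<le> T \<Longrightarrow> (y' has_real_derivative y'' s) (at s)"
      and yb: "\<And>s. \<bar>s\<bar> \<le> T \<Longrightarrow> \<bar>y'' s\<bar> \<le> K * \<bar>y s\<bar> + \<delta>"
      and "y 0 = 0" "y' 0 = 0" and t: "0 \<le> t" "t \<le> T" for y y' y'' t
  proof -
    define k where "k = K + 2"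
    have k: "k \<ge> 2" using \<open>0 \<le> K\<close> by (simp add: k_def)
    \<comment> \<open>The summand \<open>\<delta>\<^sup>2 / k\<close> absorbs the inhomogeneity and makes \<open>G\<close> nonincreasing.\<close>
    define G where "G = (\<lambda>s. ((y s)\<^sup>2 + (y' s)\<^sup>2 + \<delta>\<^sup>2 / k) * exp (- (k * s)))"
    have "G t \<le> G 0"
    proof (rule DERIV_nonpos_imp_nonincreasing[OF t(1)])
      fix s assume s: "0 \<le> s" "s \<le> t"
      then have sT: "\<bar>s\<bar> \<le> T" using t by simp
      have dG: "(G has_real_derivative
          (2 * y s * y' s + 2 * y' s * y'' s) * exp (- (k * s))
            + ((y s)\<^sup>2 + (y' s)\<^sup>2 + \<delta>\<^sup>2 / k) * (exp (- (k * s)) * (- k))) (at s)"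
        unfolding G_def
        by (rule derivative_eq_intros y[OF sT] y'[OF sT] refl | simp)+
      have "2 * y s * y' s + 2 * y' s * y'' s \<le> ((y s)\<^sup>2 + (y' s)\<^sup>2 + \<delta>\<^sup>2 / k) * k"
      proof -
        have 1: "2 * y s * y' s \<le> (y s)\<^sup>2 + (y' s)\<^sup>2"
          by (rule sum_squares_bound)
        have 2: "2 * \<bar>y' s\<bar> * \<bar>y s\<bar> \<le> (y s)\<^sup>2 + (y' s)\<^sup>2"
          using sum_squares_bound[of "\<bar>y' s\<bar>" "\<bar>y s\<bar>"] by simp
        have 3: "2 * \<bar>y' s\<bar> * \<delta> \<le> (y' s)\<^sup>2 + \<delta>\<^sup>2"
          using sum_squares_bound[of "\<bar>y' s\<bar>" "\<delta>"] by simp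
        have "2 * y' s * y'' s \<le> 2 * \<bar>y' s\<bar> * \<bar>y'' s\<bar>"
          by (metis abs_ge_self abs_mult abs_numeral)
        also have "\<dots> \<le> 2 * \<bar>y' s\<bar> * (K * \<bar>y s\<bar> + \<delta>)"
          by (intro mult_left_mono yb[OF sT]) auto
        also have "\<dots> = K * (2 * \<bar>y' s\<bar> * \<bar>y s\<bar>) + 2 * \<bar>y' s\<bar> * \<delta>"
          by (simp add: algebra_simps)
        also have "\<dots> \<le> K * ((y s)\<^sup>2 + (y' s)\<^sup>2) + ((y' s)\<^sup>2 + \<delta>\<^sup>2)"
          using mult_left_mono[OF 2 \<open>0 \<le> K\<close>] 3 by linarith
        finally have "2 * y s * y' s + 2 * y' s * y'' s
            \<le> K * ((y s)\<^sup>2 + (y' s)\<^sup>2) + ((y' s)\<^sup>2 + \<delta>\<^sup>2) + ((y s)\<^sup>2 + (y' s)\<^sup>2)"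
          using 1 by linarith
        also have "\<dots> \<le> (K + 2) * ((y s)\<^sup>2 + (y' s)\<^sup>2) + \<delta>\<^sup>2"
          by (simp add: algebra_simps)
        also have "\<dots> = ((y s)\<^sup>2 + (y' s)\<^sup>2 + \<delta>\<^sup>2 / k) * k"
          using k by (simp add: k_def field_simps)
        finally show ?thesis .
      qed
      then have "(2 * y s * y' s + 2 * y' s * y'' s) * exp (- (k * s))
          \<le> ((y s)\<^sup>2 + (y' s)\<^sup>2 + \<delta>\<^sup>2 / k) * k * exp (- (k * s))"
        by (intro mult_right_mono) auto
      moreover have "A * e + B * (e * (- k)) \<le> 0" if "A * e \<le> B * k * e" for A B e
        using that by (simp add: algebra_simps)
      ultimately have "(2 * y s * y' s + 2 * y' s * y'' s) * exp (- (k * s))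
            + ((y s)\<^sup>2 + (y' s)\<^sup>2 + \<delta>\<^sup>2 / k) * (exp (- (k * s)) * (- k)) \<le> 0"
        by blast
      with dG show "\<exists>D. (G has_real_derivative D) (at s) \<and> D \<le> 0"
        by blast
    qed
    then have "((y t)\<^sup>2 + (y' t)\<^sup>2 + \<delta>\<^sup>2 / k) * exp (- (k * t)) \<le> \<delta>\<^sup>2 / k"
      using that by (simp add: G_def)
    then have "(y t)\<^sup>2 + (y' t)\<^sup>2 + \<delta>\<^sup>2 / k \<le> \<delta>\<^sup>2 / k * exp (k * t)"
      by (simp add: exp_minus field_simps)
    also have "\<dots> \<le> \<delta>\<^sup>2 * exp (k * t)"
      using k mult_right_mono[of 1 k "\<delta>\<^sup>2"] by (intro mult_right_mono) (auto simp: field_simps)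
    finally show ?thesis
      using k by (simp add: k_def) (smt (verit) divide_nonneg_nonneg zero_le_power2)
  qed
  show ?thesis
  proof (cases "0 \<le> t")
    case True
    then show ?thesis using forward[of z z' z'' t] assms by simp
  next
    case False
    \<comment> \<open>For negative times, run the estimate on the reflected function.\<close>
    have d: "((\<lambda>s. f (- s)) has_real_derivative - D) (at s)"
      if "(f has_real_derivative D) (at (- s))" for f :: "real \<Rightarrow> real" and D s
      using that by (simp add: DERIV_mirror)
    have "(z (- (- t)))\<^sup>2 + (- z' (- (- t)))\<^sup>2 \<le> \<delta>\<^sup>2 * exp ((K + 2) * (- t))"
    proof (rule forward[where y'' = "\<lambda>s. z'' (- s)"])
      fix s :: real assume s: "\<bar>s\<bar> \<le> T"
      then have s': "\<bar>- s\<bar> \<le> T" by simp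
      show "((\<lambda>s. z (- s)) has_real_derivative - z' (- s)) (at s)"
        by (rule d) (rule z[OF s'])
      show "((\<lambda>s. - z' (- s)) has_real_derivative z'' (- s)) (at s)"
        using DERIV_minus[OF d[of z' "z'' (- s)" s]] z'[OF s'] by simp
      show "\<bar>z'' (- s)\<bar> \<le> K * \<bar>z (- s)\<bar> + \<delta>"
        by (rule bound[OF s'])
    qed (use False assms in auto)
    then show ?thesis using False by simp
  qed
qed

lemma powr_lipschitz:
  fixes x y p M :: real
  assumes "1 \<le> p" "0 < x" "x \<le> M" "0 < y" "y \<le> M"
  shows "\<bar>x powr p - y powr p\<bar> \<le> p * M powr (p - 1) * \<bar>x - y\<bar>"
proof -
  have *: "\<bar>v powr p - u powr p\<bar> \<le> p * M powr (p - 1) * \<bar>v - u\<bar>"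
    if "0 < u" "u < v" "v \<le> M" for u v
  proof -
    have "\<exists>c>u. c < v \<and> v powr p - u powr p = (v - u) * (p * c powr (p - 1))"
      using that by (intro MVT2) (auto intro!: has_real_derivative_powr)
    then obtain c where c: "u < c" "c < v" "v powr p - u powr p = (v - u) * (p * c powr (p - 1))"
      by auto
    have "c powr (p - 1) \<le> M powr (p - 1)"
      using c that assms by (intro powr_mono2) auto
    then have "(v - u) * (p * c powr (p - 1)) \<le> (v - u) * (p * M powr (p - 1))"
      using that assms by (intro mult_left_mono) auto
    moreover have "0 \<le> (v - u) * (p * c powr (p - 1))"
      using that assms by auto
    ultimately show ?thesis using c that by (simp add: mult_ac)
  qed
  consider "x < y" | "x = y" | "y < x" by linarith
  then show ?thesis
    using *[of x y] *[of y x] assms by cases (auto simp: abs_minus_commute)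
qed

lemma exp_lipschitz_nonpos:
  fixes u v :: real
  assumes "u \<le> 0" "v \<le> 0"
  shows "\<bar>exp u - exp v\<bar> \<le> \<bar>u - v\<bar>"
proof -
  have *: "\<bar>exp v - exp u\<bar> \<le> \<bar>v - u\<bar>" if "u < v" "v \<le> 0" for u v :: real
  proof -
    have "\<exists>c>u. c < v \<and> exp v - exp u = (v - u) * exp c"
      using that by (intro MVT2) (auto intro!: derivative_eq_intros)
    then obtain c where c: "u < c" "c < v" "exp v - exp u = (v - u) * exp c" by auto
    have "exp c \<le> 1" using c that by simp
    then have "(v - u) * exp c \<le> v - u" using that by (simp add: mult_left_le)
    then show ?thesis using c that by (simp add: c(3) abs_mult)
  qed
  consider "u < v" | "u = v" | "v < u" by linarith
  then show ?thesis using *[of u v] *[of v u] assms by cases (auto simp: abs_minus_commute)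
qed

text \<open>
  The limit \<open>(1 + w / p)\<^sup>p \<rightarrow> exp w\<close> with an explicit rate, uniform for \<open>w\<close> in \<open>[- W, 0]\<close>. Writing the
  power as the exponential of \<open>p ln (1 + w / p)\<close>, the error is at most the distance of the two
  exponents, since both are nonpositive, and a Taylor estimate of the logarithm bounds that distance.
\<close>
lemma exp_limit_error:
  fixes w p W :: real
  assumes "0 < p" "- W \<le> w" "w \<le> 0" "2 * W \<le> p"
  shows "\<bar>(1 + w / p) powr p - exp w\<bar> \<le> 2 * W\<^sup>2 / p"
proof -
  define x where "x = w / p"
  have x: "- (1/2) \<le> x" "x \<le> 0" using assms by (auto simp: x_def field_simps)
  have w: "w = p * x" using assms by (simp add: x_def)
  have "(1 + w / p) powr p = exp (p * ln (1 + x))"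
    using x by (simp add: powr_def x_def)
  moreover have "\<bar>exp (p * ln (1 + x)) - exp w\<bar> \<le> \<bar>p * ln (1 + x) - w\<bar>"
    using x assms by (intro exp_lipschitz_nonpos) (auto simp: mult_le_0_iff)
  moreover have "p * ln (1 + x) - w = p * (ln (1 + x) - x)"
    by (simp add: w algebra_simps)
  moreover have "\<bar>ln (1 + x) - x\<bar> \<le> 2 * x\<^sup>2"
    using x by (intro abs_ln_one_plus_x_minus_x_bound) auto
  then have "p * \<bar>ln (1 + x) - x\<bar> \<le> p * (2 * x\<^sup>2)"
    using assms by (intro mult_left_mono) auto
  moreover have "p * (2 * x\<^sup>2) = 2 * w\<^sup>2 / p"
    using assms by (simp add: x_def power2_eq_square)
  moreover have "w\<^sup>2 \<le> W\<^sup>2"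
    using assms by (intro abs_le_square_iff[THEN iffD1]) auto
  then have "2 * w\<^sup>2 / p \<le> 2 * W\<^sup>2 / p"
    using assms by (intro divide_right_mono) auto
  ultimately show ?thesis using assms by (simp add: abs_mult)
qed

section \<open>The Lane--Emden equation on an interval\<close>

text \<open>
  Positive solutions of the Dirichlet problem \<open>- v'' = v\<^sup>p\<close> on an interval. The derivative \<open>v'\<close> is
  carried along as a parameter, constrained in the open interval only.
\<close>
definition lane_emden_profile ::
  "real \<Rightarrow> real \<Rightarrow> real \<Rightarrow> (real \<Rightarrow> real) \<Rightarrow> (real \<Rightarrow> real) \<Rightarrow> bool" where
  "lane_emden_profile p \<alpha> \<beta> v v' \<longleftrightarrow>
     continuous_on {\<alpha>..\<beta>} v \<and> v \<alpha> = 0 \<and> v \<beta> = 0 \<and>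
     (\<forall>s\<in>{\<alpha><..<\<beta>}. 0 < v s \<and> (v has_real_derivative v' s) (at s) \<and>
        (v' has_real_derivative - (v s powr p)) (at s))"

text \<open>
  The equation is invariant under translations and reflections of the variable, so \<open>v (c + t)\<close> and \<open>v (c - t)\<close> solve the same
  initial value problem whenever \<open>v' c = 0\<close>; the nonlinearity is Lipschitz on the range of \<open>v\<close>
  because \<open>p \<ge> 1\<close>. The identity persists up to the first end point that is reached, by continuity.
\<close>
lemma lane_emden_profile_symmetric_about_critical_point:
  assumes prof: "lane_emden_profile p \<alpha> \<beta> v v'" and "1 \<le> p"
    and c: "\<alpha> < c" "c < \<beta>" "v' c = 0" and M: "\<And>s. s \<in> {\<alpha>..\<beta>} \<Longrightarrow> v s \<le> M"
    and t: "0 \<le> t" "t \<le> c - \<alpha>" "t \<le> \<beta> - c"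
  shows "v (c + t) = v (c - t)"
proof -
  define \<tau> where "\<tau> = min (c - \<alpha>) (\<beta> - c)"
  have "\<tau> > 0" using c by (simp add: \<tau>_def)
  have cont: "continuous_on {\<alpha>..\<beta>} v"
    and pos: "\<And>s. \<alpha> < s \<Longrightarrow> s < \<beta> \<Longrightarrow> 0 < v s"
    and dv: "\<And>s. \<alpha> < s \<Longrightarrow> s < \<beta> \<Longrightarrow> (v has_real_derivative v' s) (at s)"
    and dv': "\<And>s. \<alpha> < s \<Longrightarrow> s < \<beta> \<Longrightarrow> (v' has_real_derivative - (v s powr p)) (at s)"
    using prof by (auto simp: lane_emden_profile_def)
  define z where "z = (\<lambda>t. v (c + t) - v (c - t))"
  have zero: "z s = 0" if s: "s \<in> {0..<\<tau>}" for s
  proof -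
    have "(z s)\<^sup>2 + (v' (c + s) + v' (c - s))\<^sup>2 \<le> 0\<^sup>2 * exp ((p * M powr (p - 1) + 2) * \<bar>s\<bar>)"
    proof (rule second_order_gronwall[where T = s and z = z and
          z'' = "\<lambda>t. - (v (c + t) powr p) + v (c - t) powr p"])
      fix r :: real assume "\<bar>r\<bar> \<le> s"
      then have r: "\<alpha> < c + r" "c + r < \<beta>" "\<alpha> < c - r" "c - r < \<beta>"
        using s by (auto simp: \<tau>_def)
      have sh: "((\<lambda>t. f (c + t)) has_real_derivative D) (at r)"
        if "(f has_real_derivative D) (at (c + r))" for f D
        using that DERIV_shift[of f D r c] by (simp add: add.commute)
      have sh': "((\<lambda>t. f (c - t)) has_real_derivative - D) (at r)"
        if "(f has_real_derivative D) (at (c - r))" for f D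
      proof -
        have "((\<lambda>t. c - t) has_real_derivative - 1) (at r)"
          by (rule derivative_eq_intros refl | simp)+
        from DERIV_chain2[OF that this] show ?thesis by simp
      qed
      show "(z has_real_derivative v' (c + r) + v' (c - r)) (at r)"
        unfolding z_def using DERIV_diff[OF sh[of v "v' (c + r)"] sh'[of v "v' (c - r)"]] dv r by simp
      show "((\<lambda>s. v' (c + s) + v' (c - s)) has_real_derivative
          - (v (c + r) powr p) + v (c - r) powr p) (at r)"
        using DERIV_add[OF sh[of v' "- (v (c + r) powr p)"] sh'[of v' "- (v (c - r) powr p)"]] dv' r by simp
      have "\<bar>v (c + r) powr p - v (c - r) powr p\<bar>
          \<le> p * M powr (p - 1) * \<bar>v (c + r) - v (c - r)\<bar>"
        using r pos M \<open>1 \<le> p\<close> by (intro powr_lipschitz) auto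
      then show "\<bar>- (v (c + r) powr p) + v (c - r) powr p\<bar>
          \<le> p * M powr (p - 1) * \<bar>z r\<bar> + 0"
        by (simp add: z_def abs_minus_commute)
    qed (use c s \<open>1 \<le> p\<close> in \<open>auto simp: z_def\<close>)
    then show ?thesis by (simp add: add_nonneg_eq_0_iff sum_power2_le_zero_iff)
  qed
  have cl: "closure {0..<\<tau>} = {0..\<tau>}"
    using \<open>\<tau> > 0\<close> by simp
  have "continuous_on {0..\<tau>} (\<lambda>t. v (c + t))" "continuous_on {0..\<tau>} (\<lambda>t. v (c - t))"
    using c by (auto intro!: continuous_on_compose2[OF cont] continuous_intros simp: \<tau>_def)
  then have "continuous_on (closure {0..<\<tau>}) z"
    unfolding cl z_def by (intro continuous_on_diff)
  then have "z t = 0"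
    by (rule continuous_constant_on_closure[OF _ zero]) (use t cl in \<open>auto simp: \<tau>_def\<close>)
  then show ?thesis by (simp add: z_def)
qed

text \<open>
  Reflection in a maximum point \<open>c\<close> sends the nearer end point, where \<open>v\<close> vanishes, to another zero
  of \<open>v\<close>. As \<open>v\<close> is positive inside the interval, this image must be the other end point.
\<close>
lemma lane_emden_profile_max_at_midpoint:
  assumes prof: "lane_emden_profile p \<alpha> \<beta> v v'" and "1 \<le> p" and "\<alpha> < \<beta>"
  defines "m \<equiv> (\<alpha> + \<beta>) / 2"
  shows "\<And>s. s \<in> {\<alpha>..\<beta>} \<Longrightarrow> v s \<le> v m" and "v' m = 0"
proof -
  have cont: "continuous_on {\<alpha>..\<beta>} v" and ends: "v \<alpha> = 0" "v \<beta> = 0"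
    and pos: "\<And>s. \<alpha> < s \<Longrightarrow> s < \<beta> \<Longrightarrow> 0 < v s"
    and dv: "\<And>s. \<alpha> < s \<Longrightarrow> s < \<beta> \<Longrightarrow> (v has_real_derivative v' s) (at s)"
    using prof by (auto simp: lane_emden_profile_def)
  obtain c where c: "c \<in> {\<alpha>..\<beta>}" and max: "\<And>s. s \<in> {\<alpha>..\<beta>} \<Longrightarrow> v s \<le> v c"
    using continuous_attains_sup[OF compact_Icc _ cont] \<open>\<alpha> < \<beta>\<close> by force
  have "v m > 0" using pos \<open>\<alpha> < \<beta>\<close> by (simp add: m_def)
  moreover have "m \<in> {\<alpha>..\<beta>}" using \<open>\<alpha> < \<beta>\<close> by (simp add: m_def)
  ultimately have "v c > 0" using max[of m] by simp
  then have c': "\<alpha> < c" "c < \<beta>" using c ends by (auto simp: order.order_iff_strict)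
  define d where "d = min (c - \<alpha>) (\<beta> - c)"
  have v'c: "v' c = 0"
    by (rule DERIV_local_max[OF dv[OF c'], of d])
      (use c' max in \<open>auto simp: d_def abs_less_iff\<close>)
  note sym = lane_emden_profile_symmetric_about_critical_point[OF prof \<open>1 \<le> p\<close> c' v'c max]
  have "c = m"
  proof (rule ccontr)
    assume "c \<noteq> m"
    then consider "c - \<alpha> < \<beta> - c" | "\<beta> - c < c - \<alpha>" by (force simp: m_def)
    then show False
    proof cases
      case 1
      then have "v (c + (c - \<alpha>)) = 0" using sym[of "c - \<alpha>"] c' ends by simp
      then show False using pos[of "c + (c - \<alpha>)"] c' 1 by simp
    next
      case 2
      then have "v (c - (\<beta> - c)) = 0" using sym[of "\<beta> - c"] c' ends by simp
      then show False using pos[of "c - (\<beta> - c)"] c' 2 by simp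
    qed
  qed
  then show "\<And>s. s \<in> {\<alpha>..\<beta>} \<Longrightarrow> v s \<le> v m" and "v' m = 0"
    using max v'c by auto
qed

text \<open>
  Since \<open>\<bar>v''\<bar> \<le> M\<^sup>p\<close> for the maximum \<open>M\<close>, and \<open>v'\<close> vanishes at the midpoint, the profile cannot
  fall from \<open>M\<close> to \<open>0\<close> within the interval unless \<open>M \<le> M\<^sup>p (\<beta> - \<alpha>)\<^sup>2\<close>.
\<close>
lemma lane_emden_profile_max_lower_bound:
  assumes prof: "lane_emden_profile p \<alpha> \<beta> v v'" and "1 \<le> p" and "\<alpha> < \<beta>"
  shows "1 \<le> v ((\<alpha> + \<beta>) / 2) powr (p - 1) * (\<beta> - \<alpha>)\<^sup>2"
proof -
  define m where "m = (\<alpha> + \<beta>) / 2"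
  define M where "M = v m"
  have m: "\<alpha> < m" "m < \<beta>" using \<open>\<alpha> < \<beta>\<close> by (auto simp: m_def)
  have cont: "continuous_on {\<alpha>..\<beta>} v" and ends: "v \<alpha> = 0" "v \<beta> = 0"
    and pos: "\<And>s. \<alpha> < s \<Longrightarrow> s < \<beta> \<Longrightarrow> 0 < v s"
    and dv: "\<And>s. \<alpha> < s \<Longrightarrow> s < \<beta> \<Longrightarrow> (v has_real_derivative v' s) (at s)"
    and dv': "\<And>s. \<alpha> < s \<Longrightarrow> s < \<beta> \<Longrightarrow> (v' has_real_derivative - (v s powr p)) (at s)"
    using prof by (auto simp: lane_emden_profile_def)
  have max: "\<And>s. s \<in> {\<alpha>..\<beta>} \<Longrightarrow> v s \<le> M" and v'm: "v' m = 0"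
    using lane_emden_profile_max_at_midpoint[OF prof \<open>1 \<le> p\<close> \<open>\<alpha> < \<beta>\<close>] by (auto simp: m_def M_def)
  have "M > 0" using pos m by (simp add: M_def)
  have slope: "- v' s \<le> M powr p * (\<beta> - \<alpha>)" if s: "m < s" "s < \<beta>" for s
  proof -
    have "\<exists>r>m. r < s \<and> v' s - v' m = (s - m) * - (v r powr p)"
      using s m by (intro MVT2 dv') auto
    then obtain r where r: "m < r" "r < s" "v' s - v' m = (s - m) * - (v r powr p)" by auto
    have "v r powr p \<le> M powr p"
      using r s m pos[of r] max[of r] \<open>1 \<le> p\<close> by (intro powr_mono2) auto
    then have "v r powr p * (s - m) \<le> M powr p * (\<beta> - \<alpha>)"
      using s m by (intro mult_mono) auto
    then show ?thesis using r v'm by (simp add: algebra_simps)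
  qed
  have "\<exists>r. m < r \<and> r < \<beta> \<and> v \<beta> - v m = (\<beta> - m) * v' r"
  proof -
    have "continuous_on {m..\<beta>} v" by (rule continuous_on_subset[OF cont]) (use m in auto)
    then obtain l r where "m < r" "r < \<beta>" "DERIV v r :> l" "v \<beta> - v m = (\<beta> - m) * l"
      using MVT[of m \<beta> v] m dv by (metis order.strict_trans real_differentiable_def)
    then show ?thesis using DERIV_unique dv m by (metis order.strict_trans)
  qed
  then obtain r where r: "m < r" "r < \<beta>" "M = (\<beta> - m) * - v' r"
    using ends by (auto simp: M_def)
  have "M \<le> (\<beta> - m) * (M powr p * (\<beta> - \<alpha>))"
    unfolding r(3)[symmetric] using m by (subst r(3)) (intro mult_left_mono slope r, simp)
  also have "\<dots> \<le> (\<beta> - \<alpha>) * (M powr p * (\<beta> - \<alpha>))"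
    using m by (intro mult_right_mono) auto
  also have "M powr p = M * M powr (p - 1)"
    using \<open>M > 0\<close> by (simp add: powr_diff)
  finally have "M * 1 \<le> M * (M powr (p - 1) * (\<beta> - \<alpha>)\<^sup>2)"
    by (simp add: power2_eq_square mult_ac)
  then have "1 \<le> M powr (p - 1) * (\<beta> - \<alpha>)\<^sup>2"
    using \<open>M > 0\<close> by (simp only: mult_le_cancel_left_pos)
  then show ?thesis by (simp add: M_def m_def)
qed

text \<open>
  The lower bound for the maximum is exactly what makes the length scale \<open>\<epsilon>\<close> shrink: it turns
  the normalisation into \<open>p \<epsilon>\<^sup>2 \<le> (\<beta> - \<alpha>)\<^sup>2\<close>.
\<close>
lemma lane_emden_rescaling_bound:
  assumes prof: "lane_emden_profile p \<alpha> \<beta> v v'" and "1 \<le> p" and "\<alpha> < \<beta>"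
    and "0 < \<epsilon>" and \<epsilon>: "p * \<epsilon>\<^sup>2 * v ((\<alpha> + \<beta>) / 2) powr (p - 1) = 1"
  shows "\<epsilon> \<le> (\<beta> - \<alpha>) / sqrt p"
proof -
  define P where "P = v ((\<alpha> + \<beta>) / 2) powr (p - 1)"
  have "0 < P"
    using \<epsilon> by (simp add: P_def) (metis less_numeral_extra(1) mult_zero_right not_less_iff_gr_or_eq powr_eq_0_iff)
  have "p * \<epsilon>\<^sup>2 * P \<le> (\<beta> - \<alpha>)\<^sup>2 * P"
    using lane_emden_profile_max_lower_bound[OF assms(1-3)] \<epsilon> by (simp add: P_def mult.commute)
  then have "p * \<epsilon>\<^sup>2 \<le> (\<beta> - \<alpha>)\<^sup>2"
    using \<open>0 < P\<close> by simp
  then have "(\<epsilon> * sqrt p)\<^sup>2 \<le> (\<beta> - \<alpha>)\<^sup>2"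
    using \<open>1 \<le> p\<close> by (simp add: power_mult_distrib mult.commute)
  then have "\<epsilon> * sqrt p \<le> \<beta> - \<alpha>"
    by (rule power2_le_imp_le) (use \<open>\<alpha> < \<beta>\<close> in simp)
  then show ?thesis using \<open>1 \<le> p\<close> by (simp add: field_simps)
qed

section \<open>Approximation of the Liouville equation\<close>

text \<open>
  The solution of Liouville's equation \<open>- U'' = exp U\<close> with \<open>U 0 = U' 0 = 0\<close>.
\<close>
definition liouville_bubble :: "real \<Rightarrow> real" where
  "liouville_bubble t = ln (4 * exp (sqrt 2 * t) / (1 + exp (sqrt 2 * t))\<^sup>2)"

definition liouville_bubble' :: "real \<Rightarrow> real" where
  "liouville_bubble' t = sqrt 2 * (1 - exp (sqrt 2 * t)) / (1 + exp (sqrt 2 * t))"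

lemma liouville_bubble_has_derivative:
  "(liouville_bubble has_real_derivative liouville_bubble' t) (at t)"
proof -
  have eq: "liouville_bubble = (\<lambda>t. ln 4 + sqrt 2 * t - 2 * ln (1 + exp (sqrt 2 * t)))"
  proof
    fix t :: real
    have "1 + exp (sqrt 2 * t) > 0" by (simp add: add_pos_pos)
    then show "liouville_bubble t = ln 4 + sqrt 2 * t - 2 * ln (1 + exp (sqrt 2 * t))"
      by (simp add: liouville_bubble_def ln_div ln_mult ln_realpow)
  qed
  have "1 + exp (sqrt 2 * t) > 0" by (simp add: add_pos_pos)
  then show ?thesis
    unfolding eq liouville_bubble'_def
    by (auto intro!: derivative_eq_intros simp: field_simps)
qed

lemma exp_liouville_bubble:
  "exp (liouville_bubble t) = 4 * exp (sqrt 2 * t) / (1 + exp (sqrt 2 * t))\<^sup>2"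
proof -
  have "1 + exp (sqrt 2 * t) > 0" by (simp add: add_pos_pos)
  then show ?thesis by (simp add: liouville_bubble_def)
qed

lemma liouville_bubble'_has_derivative:
  "(liouville_bubble' has_real_derivative - exp (liouville_bubble t)) (at t)"
proof -
  define e where "e = exp (sqrt 2 * t)"
  have e: "1 + e > 0" by (simp add: e_def add_pos_pos)
  have "(liouville_bubble' has_real_derivative
     (sqrt 2 * (- (e * sqrt 2)) * (1 + e) - sqrt 2 * (1 - e) * (e * sqrt 2))
        / ((1 + e) * (1 + e))) (at t)"
    unfolding liouville_bubble'_def[abs_def] e_def using e[unfolded e_def]
    by (auto intro!: derivative_eq_intros)
  also have "sqrt 2 * (- (e * sqrt 2)) * (1 + e) - sqrt 2 * (1 - e) * (e * sqrt 2)
      = (sqrt 2 * sqrt 2) * - (2 * e)"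
    by (simp add: algebra_simps)
  also have "\<dots> / ((1 + e) * (1 + e)) = - exp (liouville_bubble t)"
    by (simp add: exp_liouville_bubble e_def power2_eq_square)
  finally show ?thesis .
qed

lemma liouville_bubble_nonpos: "liouville_bubble t \<le> 0"
proof -
  define e where "e = exp (sqrt 2 * t)"
  have e: "1 + e > 0" by (simp add: e_def add_pos_pos)
  have "0 \<le> (1 - e)\<^sup>2" by simp
  then have "4 * e \<le> (1 + e)\<^sup>2" by (simp add: power2_eq_square algebra_simps)
  then have "exp (liouville_bubble t) \<le> 1"
    using e by (simp add: exp_liouville_bubble flip: e_def)
  then show ?thesis by simp
qed

text \<open>
  The rescaled profile \<open>w\<close> solves \<open>- w'' = (1 + w / p)\<^sup>p\<close> with \<open>w 0 = w' 0 = 0\<close>: the normalisation of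
  \<open>\<epsilon>\<close> cancels all constants, and the midpoint is the maximum point of \<open>v\<close>. Since \<open>0 \<le> 1 + w / p \<le> 1\<close>,
  the second derivative is bounded by 1, which gives \<open>\<bar>w\<bar> \<le> R\<^sup>2\<close> on \<open>[- R, R]\<close> without
  compactness arguments. On that range the right-hand side differs from \<open>exp w\<close> by \<open>O(1 / p)\<close>, and
  the Gronwall estimate transfers this rate to \<open>w\<close> and \<open>w'\<close>.
\<close>
lemma rescaled_lane_emden_profile_estimate:
  assumes prof: "lane_emden_profile p \<alpha> \<beta> v v'" and "1 < p" and "\<alpha> < \<beta>"
    and m: "m = (\<alpha> + \<beta>) / 2" and "0 < \<epsilon>" and \<epsilon>: "p * \<epsilon>\<^sup>2 * v m powr (p - 1) = 1"
    and R: "0 \<le> R" "R < (\<beta> - \<alpha>) / (2 * \<epsilon>)" "2 * R\<^sup>2 \<le> p" and t: "\<bar>t\<bar> \<le> R"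
  shows "\<bar>p / v m * (v (\<epsilon> * t + m) - v m) - liouville_bubble t\<bar> \<le> 2 * R ^ 4 * exp (3 * R / 2) / p"
    and "\<bar>p / v m * (\<epsilon> * v' (\<epsilon> * t + m)) - liouville_bubble' t\<bar> \<le> 2 * R ^ 4 * exp (3 * R / 2) / p"
proof -
  define M where "M = v m"
  define w where "w = (\<lambda>t. p / M * (v (\<epsilon> * t + m) - M))"
  define w' where "w' = (\<lambda>t. p / M * (\<epsilon> * v' (\<epsilon> * t + m)))"
  define w'' where "w'' = (\<lambda>t. - ((1 + w t / p) powr p))"
  have pos: "\<And>s. \<alpha> < s \<Longrightarrow> s < \<beta> \<Longrightarrow> 0 < v s"
    and dv: "\<And>s. \<alpha> < s \<Longrightarrow> s < \<beta> \<Longrightarrow> (v has_real_derivative v' s) (at s)"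
    and dv': "\<And>s. \<alpha> < s \<Longrightarrow> s < \<beta> \<Longrightarrow> (v' has_real_derivative - (v s powr p)) (at s)"
    using prof by (auto simp: lane_emden_profile_def)
  have max: "\<And>s. s \<in> {\<alpha>..\<beta>} \<Longrightarrow> v s \<le> M" and v'm: "v' m = 0"
    using lane_emden_profile_max_at_midpoint[OF prof _ \<open>\<alpha> < \<beta>\<close>] \<open>1 < p\<close>
    by (auto simp: m M_def)
  have "M > 0" using pos \<open>\<alpha> < \<beta>\<close> by (simp add: M_def m)
  have inside: "\<alpha> < \<epsilon> * s + m" "\<epsilon> * s + m < \<beta>" if "\<bar>s\<bar> \<le> R" for s
  proof -
    have "\<bar>\<epsilon> * s\<bar> \<le> \<epsilon> * R" using that \<open>0 < \<epsilon>\<close> by (simp add: abs_mult)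
    also have "\<dots> < (\<beta> - \<alpha>) / 2" using R(2) \<open>0 < \<epsilon>\<close> by (simp add: field_simps)
    finally have "\<bar>\<epsilon> * s\<bar> < (\<beta> - \<alpha>) / 2" .
    then show "\<alpha> < \<epsilon> * s + m" "\<epsilon> * s + m < \<beta>"
      unfolding m by (simp_all add: abs_less_iff field_simps)
  qed
  have chain: "((\<lambda>t. f (\<epsilon> * t + m)) has_real_derivative \<epsilon> * D) (at s)"
    if "(f has_real_derivative D) (at (\<epsilon> * s + m))" for f D s
  proof -
    have "((\<lambda>t. \<epsilon> * t + m) has_real_derivative \<epsilon>) (at s)"
      by (rule derivative_eq_intros refl | simp)+
    from DERIV_chain2[OF that this] show ?thesis by (simp add: mult.commute)
  qed
  have w1: "1 + w s / p = v (\<epsilon> * s + m) / M" for s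
    using \<open>M > 0\<close> \<open>1 < p\<close> by (simp add: w_def field_simps)
  have dw: "(w has_real_derivative w' s) (at s)" if "\<bar>s\<bar> \<le> R" for s
    unfolding w_def w'_def
    by (rule derivative_eq_intros chain dv inside that refl | simp)+
  have dw': "(w' has_real_derivative w'' s) (at s)" if "\<bar>s\<bar> \<le> R" for s
  proof -
    have "(w' has_real_derivative p / M * (\<epsilon> * (\<epsilon> * - (v (\<epsilon> * s + m) powr p)))) (at s)"
      unfolding w'_def
      by (rule derivative_eq_intros chain dv' inside that refl | simp)+
    moreover have "p / M * (\<epsilon> * (\<epsilon> * - (v (\<epsilon> * s + m) powr p))) = w'' s"
    proof -
      have "w'' s = - (v (\<epsilon> * s + m) powr p / M powr p)"
        unfolding w''_def w1 using pos[OF inside[OF that]] \<open>M > 0\<close> by (simp add: powr_divide)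
      also have "M powr p = M * M powr (p - 1)"
        using \<open>M > 0\<close> by (simp add: powr_diff)
      also have "- (v (\<epsilon> * s + m) powr p / (M * M powr (p - 1)))
          = p / M * (\<epsilon> * (\<epsilon> * - (v (\<epsilon> * s + m) powr p)))"
      proof -
        have "M powr (p - 1) = 1 / (p * \<epsilon>\<^sup>2)"
          using \<epsilon> \<open>0 < \<epsilon>\<close> \<open>1 < p\<close> by (simp add: M_def field_simps)
        then show ?thesis
          using \<open>0 < \<epsilon>\<close> \<open>1 < p\<close> \<open>M > 0\<close> by (simp add: field_simps power2_eq_square)
      qed
      finally show ?thesis by simp
    qed
    ultimately show ?thesis by simp
  qed
  have w0: "w 0 = 0" "w' 0 = 0"
    by (simp_all add: w_def w'_def M_def v'm)
  have wle: "w s \<le> 0" if "\<bar>s\<bar> \<le> R" for s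
    using max[of "\<epsilon> * s + m"] inside[OF that] \<open>M > 0\<close> \<open>1 < p\<close>
    by (auto simp: w_def mult_le_0_iff divide_le_0_iff)
  have w''_bound: "\<bar>w'' s\<bar> \<le> 1" if "\<bar>s\<bar> \<le> R" for s
  proof -
    have "0 \<le> 1 + w s / p" using pos[OF inside[OF that]] \<open>M > 0\<close> by (simp add: w1)
    moreover have "1 + w s / p \<le> 1" using wle[OF that] \<open>1 < p\<close> by (simp add: divide_le_0_iff)
    ultimately show ?thesis using \<open>1 < p\<close> by (simp add: w''_def powr_le1)
  qed
  have w'_bound: "\<bar>w' s\<bar> \<le> R" if s: "\<bar>s\<bar> \<le> R" for s
  proof -
    have "norm (w' s - w' 0) \<le> 1 * norm (s - 0)"
    proof (rule field_differentiable_bound[of "{- R..R}"])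
      fix r assume "r \<in> {- R..R}"
      then have r: "\<bar>r\<bar> \<le> R" by auto
      show "(w' has_real_derivative w'' r) (at r within {- R..R})"
        by (rule has_field_derivative_at_within[OF dw'[OF r]])
      show "norm (w'' r) \<le> 1" using w''_bound[OF r] by simp
    qed (use s R in auto)
    then show ?thesis using s w0 by simp
  qed
  have w_bound: "\<bar>w s\<bar> \<le> R\<^sup>2" if s: "\<bar>s\<bar> \<le> R" for s
  proof -
    have "norm (w s - w 0) \<le> R * norm (s - 0)"
    proof (rule field_differentiable_bound[of "{- R..R}"])
      fix r assume "r \<in> {- R..R}"
      then have r: "\<bar>r\<bar> \<le> R" by auto
      show "(w has_real_derivative w' r) (at r within {- R..R})"
        by (rule has_field_derivative_at_within[OF dw[OF r]])
      show "norm (w' r) \<le> R" using w'_bound[OF r] by simp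
    qed (use s R in auto)
    also have "\<dots> \<le> R * R" using s R by (intro mult_left_mono) auto
    finally show ?thesis using w0 by (simp add: power2_eq_square)
  qed
  define \<delta> where "\<delta> = 2 * (R\<^sup>2)\<^sup>2 / p"
  have "0 \<le> \<delta>" using \<open>1 < p\<close> by (simp add: \<delta>_def)
  have "(w t - liouville_bubble t)\<^sup>2 + (w' t - liouville_bubble' t)\<^sup>2
      \<le> \<delta>\<^sup>2 * exp ((1 + 2) * \<bar>t\<bar>)"
  proof (rule second_order_gronwall[where T = R and z'' = "\<lambda>s. w'' s + exp (liouville_bubble s)"])
    fix s assume s: "\<bar>s\<bar> \<le> R"
    show "((\<lambda>s. w s - liouville_bubble s) has_real_derivative w' s - liouville_bubble' s) (at s)"
      by (intro DERIV_diff dw s liouville_bubble_has_derivative)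
    show "((\<lambda>s. w' s - liouville_bubble' s) has_real_derivative
        w'' s + exp (liouville_bubble s)) (at s)"
      using DERIV_diff[OF dw'[OF s] liouville_bubble'_has_derivative] by simp
    \<comment> \<open>Split the difference of the two right-hand sides at \<open>exp (w s)\<close>.\<close>
    have "\<bar>(1 + w s / p) powr p - exp (w s)\<bar> \<le> \<delta>"
      unfolding \<delta>_def using w_bound[OF s] wle[OF s] \<open>1 < p\<close> R
      by (intro exp_limit_error) auto
    moreover have "\<bar>exp (w s) - exp (liouville_bubble s)\<bar> \<le> \<bar>w s - liouville_bubble s\<bar>"
      by (intro exp_lipschitz_nonpos wle s liouville_bubble_nonpos)
    ultimately show "\<bar>w'' s + exp (liouville_bubble s)\<bar>
        \<le> 1 * \<bar>w s - liouville_bubble s\<bar> + \<delta>"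
      unfolding w''_def mult_1 by linarith
  qed (use t w0 \<open>0 \<le> \<delta>\<close> in \<open>auto simp: liouville_bubble_def liouville_bubble'_def\<close>)
  also have "\<dots> \<le> \<delta>\<^sup>2 * exp (3 * R)"
    using t by (intro mult_left_mono) auto
  also have "\<dots> = (\<delta> * exp (3 * R / 2))\<^sup>2"
    by (simp add: power_mult_distrib flip: exp_double)
  also have "\<delta> * exp (3 * R / 2) = 2 * R ^ 4 * exp (3 * R / 2) / p"
    by (simp add: \<delta>_def flip: power_mult)
  finally have sq: "(w t - liouville_bubble t)\<^sup>2 + (w' t - liouville_bubble' t)\<^sup>2
      \<le> (2 * R ^ 4 * exp (3 * R / 2) / p)\<^sup>2" .
  have "(w t - liouville_bubble t)\<^sup>2 \<le> (2 * R ^ 4 * exp (3 * R / 2) / p)\<^sup>2"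
    and "(w' t - liouville_bubble' t)\<^sup>2 \<le> (2 * R ^ 4 * exp (3 * R / 2) / p)\<^sup>2"
    using sq zero_le_power2[of "w t - liouville_bubble t"]
      zero_le_power2[of "w' t - liouville_bubble' t"] by linarith+
  moreover have "0 \<le> 2 * R ^ 4 * exp (3 * R / 2) / p" using \<open>1 < p\<close> R by simp
  ultimately have "\<bar>w t - liouville_bubble t\<bar> \<le> 2 * R ^ 4 * exp (3 * R / 2) / p"
    and "\<bar>w' t - liouville_bubble' t\<bar> \<le> 2 * R ^ 4 * exp (3 * R / 2) / p"
    by (simp_all add: abs_le_square_iff[symmetric])
  then show "\<bar>p / v m * (v (\<epsilon> * t + m) - v m) - liouville_bubble t\<bar>
      \<le> 2 * R ^ 4 * exp (3 * R / 2) / p"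
    and "\<bar>p / v m * (\<epsilon> * v' (\<epsilon> * t + m)) - liouville_bubble' t\<bar>
      \<le> 2 * R ^ 4 * exp (3 * R / 2) / p"
    by (simp_all add: w_def w'_def M_def)
qed

section \<open>Radial functions on an annulus\<close>

lemma C1_on_has_directional_derivative:
  fixes f :: "real ^ 'n \<Rightarrow> real"
  assumes "C1_on S f" and "x + t *\<^sub>R axis i 1 \<in> S"
  shows "((\<lambda>s. f (x + s *\<^sub>R axis i 1)) has_real_derivative
           partial_deriv i f (x + t *\<^sub>R axis i 1)) (at t)"
proof -
  have "(\<lambda>s. f (x + t *\<^sub>R axis i 1 + s *\<^sub>R axis i 1)) differentiable (at 0)"
    using assms unfolding C1_on_def by blast
  then have "((\<lambda>s. f (x + t *\<^sub>R axis i 1 + s *\<^sub>R axis i 1)) has_real_derivative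
      partial_deriv i f (x + t *\<^sub>R axis i 1)) (at 0)"
    unfolding partial_deriv_def by (simp add: DERIV_deriv_iff_real_differentiable)
  then show ?thesis
    using DERIV_shift[of "\<lambda>s. f (x + s *\<^sub>R axis i 1)" _ 0 t]
    by (simp add: algebra_simps)
qed

lemma open_annulus: "open (annulus a b :: (real ^ 'n) set)"
  unfolding annulus_def
  by (intro open_Collect_conj open_Collect_less continuous_intros)

lemma norm_axis_plus_orthogonal:
  fixes i j :: "'n::finite"
  assumes "i \<noteq> j"
  shows "norm (r *\<^sub>R axis i 1 + t *\<^sub>R axis j 1 :: real ^ 'n) = sqrt (r\<^sup>2 + t\<^sup>2)"
  using assms
  by (simp add: norm_eq_sqrt_inner inner_add_left inner_add_right inner_axis_axis power2_eq_square)

text \<open>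
  The radial form of the Laplacian, obtained at points of a coordinate axis from iterated
  one-dimensional derivatives along coordinate lines. Along the axis itself the partial derivatives
  are those of the profile \<open>\<phi>\<close>. Along a line orthogonal to it the function is
  \<open>\<phi> (sqrt (r\<^sup>2 + t\<^sup>2))\<close>, whose first derivative \<open>\<phi>'(\<rho>) t / \<rho>\<close> vanishes at \<open>t = 0\<close> and has slope
  \<open>\<phi>'(r) / r\<close> there. By radial symmetry these points suffice to determine the equation for \<open>\<phi>\<close>.
\<close>
lemma radial_laplacian:
  fixes u :: "real ^ 'n \<Rightarrow> real" and i :: 'n
  assumes C2: "C2_on (annulus a b) u" and radial: "radial_on (annulus a b) u"
    and r: "0 \<le> a" "a < r" "r < b"
  defines "\<phi> \<equiv> \<lambda>r. u (r *\<^sub>R axis i 1)"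
    and "\<phi>' \<equiv> \<lambda>r. partial_deriv i u (r *\<^sub>R axis i 1)"
    and "\<phi>'' \<equiv> \<lambda>r. partial_deriv i (partial_deriv i u) (r *\<^sub>R axis i 1)"
  shows "(\<phi> has_real_derivative \<phi>' r) (at r)"
    and "(\<phi>' has_real_derivative \<phi>'' r) (at r)"
    and "laplacian u (r *\<^sub>R axis i 1) = \<phi>'' r + (real CARD('n) - 1) / r * \<phi>' r"
proof -
  have C1: "C1_on (annulus a b) u" and C1': "\<And>i. C1_on (annulus a b) (partial_deriv i u)"
    using C2 by (auto simp: C2_on_def)
  have d\<phi>: "(\<phi> has_real_derivative \<phi>' s) (at s)" if "a < s" "s < b" for s
    using C1_on_has_directional_derivative[OF C1, of 0 s i] that r
    by (simp add: \<phi>_def \<phi>'_def annulus_def norm_axis_1)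
  have d\<phi>': "(\<phi>' has_real_derivative \<phi>'' s) (at s)" if "a < s" "s < b" for s
    using C1_on_has_directional_derivative[OF C1', of 0 s i] that r
    by (simp add: \<phi>'_def \<phi>''_def annulus_def norm_axis_1)
  show "(\<phi> has_real_derivative \<phi>' r) (at r)" "(\<phi>' has_real_derivative \<phi>'' r) (at r)"
    using d\<phi> d\<phi>' r by auto
  have tangential: "partial_deriv j (partial_deriv j u) (r *\<^sub>R axis i 1) = \<phi>' r / r"
    if "j \<noteq> i" for j
  proof -
    define \<rho> where "\<rho> = (\<lambda>t. sqrt (r\<^sup>2 + t\<^sup>2))"
    define line where "line = (\<lambda>t. r *\<^sub>R axis i 1 + t *\<^sub>R axis j 1 :: real ^ 'n)"
    define T where "T = {t. line t \<in> annulus a b}"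
    have norm_line: "norm (line t) = \<rho> t" for t
      unfolding line_def \<rho>_def using that by (intro norm_axis_plus_orthogonal) auto
    have T: "t \<in> T \<longleftrightarrow> a < \<rho> t \<and> \<rho> t < b" for t
      by (simp add: T_def annulus_def norm_line)
    have "open T"
      unfolding T_def line_def annulus_def mem_Collect_eq
      by (intro open_Collect_conj open_Collect_less continuous_intros)
    have \<rho>0: "\<rho> 0 = r" using r by (simp add: \<rho>_def)
    then have "0 \<in> T" using r by (simp add: T)
    have \<rho>_pos: "0 < \<rho> t" for t
      using r by (simp add: \<rho>_def add_pos_nonneg)
    have d\<rho>: "(\<rho> has_real_derivative t / \<rho> t) (at t)" for t
    proof -
      have "0 < r\<^sup>2 + t\<^sup>2" using r by (simp add: add_pos_nonneg)
      then show ?thesis unfolding \<rho>_def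
        by (auto intro!: derivative_eq_intros simp: field_simps)
    qed
    have along: "u (line t) = \<phi> (\<rho> t)" if "t \<in> T" for t
    proof -
      have "norm (\<rho> t *\<^sub>R axis i 1 :: real ^ 'n) = \<rho> t"
        using \<rho>_pos[of t] by (simp add: norm_axis_1)
      then show ?thesis
        using radial that norm_line[of t] unfolding \<phi>_def radial_on_def
        by (metis (mono_tags, lifting) T T_def annulus_def mem_Collect_eq)
    qed
    have first: "partial_deriv j u (line t) = \<phi>' (\<rho> t) * (t / \<rho> t)" if t: "t \<in> T" for t
    proof (rule DERIV_unique)
      show "((\<lambda>s. u (line s)) has_real_derivative partial_deriv j u (line t)) (at t)"
        using C1_on_has_directional_derivative[OF C1, of "r *\<^sub>R axis i 1" t j] t
        by (simp add: line_def T_def)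
      have "((\<lambda>s. \<phi> (\<rho> s)) has_real_derivative \<phi>' (\<rho> t) * (t / \<rho> t)) (at t)"
        using t by (intro DERIV_chain2[OF d\<phi> d\<rho>]) (auto simp: T)
      then show "((\<lambda>s. u (line s)) has_real_derivative \<phi>' (\<rho> t) * (t / \<rho> t)) (at t)"
        by (rule has_field_derivative_transform_within_open[OF _ \<open>open T\<close> t]) (simp add: along)
    qed
    have d\<phi>'\<rho>: "((\<lambda>t. \<phi>' (\<rho> t)) has_real_derivative \<phi>'' (\<rho> 0) * (0 / \<rho> 0)) (at 0)"
      using r by (intro DERIV_chain2[OF d\<phi>' d\<rho>]) (auto simp: \<rho>0)
    have "((\<lambda>t. \<phi>' (\<rho> t) * (t / \<rho> t)) has_real_derivative \<phi>' r / r) (at 0)"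
      using r by (auto intro!: derivative_eq_intros d\<phi>'\<rho> d\<rho> simp: \<rho>0)
    then have "((\<lambda>t. partial_deriv j u (line t)) has_real_derivative \<phi>' r / r) (at 0)"
      by (rule has_field_derivative_transform_within_open[OF _ \<open>open T\<close> \<open>0 \<in> T\<close>]) (simp add: first)
    then show ?thesis
      unfolding partial_deriv_def[of j "partial_deriv j u"] line_def by (rule DERIV_imp_deriv)
  qed
  have "laplacian u (r *\<^sub>R axis i 1) = \<phi>'' r + (\<Sum>j\<in>UNIV - {i}. \<phi>' r / r)"
    unfolding laplacian_def by (subst sum.remove[of UNIV i]) (auto simp: tangential \<phi>''_def)
  also have "(\<Sum>j\<in>UNIV - {i}. \<phi>' r / r) = (real CARD('n) - 1) / r * \<phi>' r"
    by (simp add: of_nat_diff Suc_leI)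
  finally show "laplacian u (r *\<^sub>R axis i 1) = \<phi>'' r + (real CARD('n) - 1) / r * \<phi>' r" .
qed

text \<open>
  The essential supremum cannot be exceeded at \<open>x\<^sub>0\<close>: by continuity it would be exceeded on a nonempty
  open set, and such a set is not negligible.
\<close>
lemma Linfty_norm_eq_max:
  fixes f :: "real ^ 'n \<Rightarrow> real"
  assumes "open S" and cont: "continuous_on S f" and "x\<^sub>0 \<in> S"
    and max: "\<And>x. x \<in> S \<Longrightarrow> \<bar>f x\<bar> \<le> \<bar>f x\<^sub>0\<bar>"
  shows "Linfty_norm S f = \<bar>f x\<^sub>0\<bar>"
proof -
  define g where "g = (\<lambda>x. ereal \<bar>f x\<bar>)"
  have contg: "continuous_on S g"
    unfolding g_def by (intro continuous_intros cont)
  have meas: "g \<in> borel_measurable (lebesgue_on S)"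
  proof -
    have "f \<in> borel_measurable (lebesgue_on S)"
      using \<open>open S\<close> by (intro continuous_imp_measurable_on_sets_lebesgue cont) auto
    then show ?thesis unfolding g_def by measurable
  qed
  define c where "c = esssup (lebesgue_on S) g"
  have "c \<le> g x\<^sub>0"
    unfolding c_def by (intro esssup_I meas AE_I2) (auto simp: g_def max)
  moreover have "\<not> c < g x\<^sub>0"
  proof
    assume "c < g x\<^sub>0"
    define T where "T = S \<inter> g -` {c<..}"
    have "open T"
      unfolding T_def by (intro continuous_open_preimage contg \<open>open S\<close>) auto
    moreover have "x\<^sub>0 \<in> T" using \<open>c < g x\<^sub>0\<close> \<open>x\<^sub>0 \<in> S\<close> by (simp add: T_def)
    ultimately have "\<not> negligible T" using open_not_negligible by blast
    moreover have "negligible T"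
    proof -
      have "T = {x \<in> space (lebesgue_on S). g x > esssup (lebesgue_on S) g}"
        by (auto simp: T_def c_def)
      then have "emeasure (lebesgue_on S) T = 0"
        using esssup_zero_measure[of "lebesgue_on S" g] by simp
      then have "emeasure lebesgue T = 0"
        using \<open>open S\<close> by (subst (asm) emeasure_restrict_space) (auto simp: T_def)
      moreover have "T \<in> sets lebesgue" using \<open>open T\<close> by auto
      ultimately show ?thesis by (simp add: negligible_iff_null_sets null_sets_def)
    qed
    ultimately show False by simp
  qed
  ultimately have "c = g x\<^sub>0" by simp
  then show ?thesis by (simp add: Linfty_norm_def c_def g_def)
qed

text \<open>
  In the variable \<open>s = r\<^bsup>2-N\<^esup>\<close>, the fundamental solution of the Laplacian, the first-order term of
  the radial Laplacian disappears, and \<open>\<Delta> = (N - 2)\<^sup>2 r\<^bsup>-2(N-1)\<^esup> d\<^sup>2/ds\<^sup>2\<close>. The weight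
  in the equation is chosen to cancel against this factor, leaving \<open>- v'' = v\<^sup>p\<close>. The substitution
  reverses the order, so \<open>b\<close> corresponds to the left end point.
\<close>
lemma radial_solution_lane_emden_profile:
  fixes u :: "real ^ 'n \<Rightarrow> real"
  assumes sol: "radial_solution N a b p u" and "CARD('n) = N" and "N \<ge> 3"
    and "0 < a" and "a < b" and "1 \<le> p"
  defines "\<alpha> \<equiv> b powr (2 - real N)" and "\<beta> \<equiv> a powr (2 - real N)"
  obtains v v' where "lane_emden_profile p \<alpha> \<beta> v v'"
    and "\<And>s. \<alpha> < s \<Longrightarrow> s < \<beta> \<Longrightarrow> radial_profile u (s powr (1 / (2 - real N))) = v s"
    and "Linfty_norm (annulus a b) u = v ((\<alpha> + \<beta>) / 2)"
proof -
  define S :: "(real ^ 'n) set" where "S = annulus a b"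
  have C2: "C2_on S u" and cont: "continuous_on (closure S) u"
    and pde: "\<And>x. x \<in> S \<Longrightarrow>
        - laplacian u x = (real N - 2)\<^sup>2 * (u x powr p / norm x ^ (2 * (N - 1)))"
    and pos: "\<And>x. x \<in> S \<Longrightarrow> 0 < u x" and bdry: "\<And>x. x \<in> frontier S \<Longrightarrow> u x = 0"
    and radial_cl: "radial_on (closure S) u"
    using sol by (auto simp: radial_solution_def S_def)
  have radial: "radial_on S u"
    using radial_cl closure_subset[of S] unfolding radial_on_def by blast
  have mem_S: "x \<in> S \<longleftrightarrow> a < norm x \<and> norm x < b" for x
    by (simp add: S_def annulus_def)
  obtain i :: 'n where True by simp
  define \<phi> where "\<phi> = (\<lambda>r. u (r *\<^sub>R axis i 1))"
  define \<phi>' where "\<phi>' = (\<lambda>r. partial_deriv i u (r *\<^sub>R axis i 1))"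
  define \<phi>'' where "\<phi>'' = (\<lambda>r. partial_deriv i (partial_deriv i u) (r *\<^sub>R axis i 1))"
  have lap: "(\<phi> has_real_derivative \<phi>' r) (at r)" "(\<phi>' has_real_derivative \<phi>'' r) (at r)"
      "laplacian u (r *\<^sub>R axis i 1) = \<phi>'' r + (real N - 1) / r * \<phi>' r"
    if "a < r" "r < b" for r
    unfolding \<phi>_def \<phi>'_def \<phi>''_def
    using radial_laplacian[where i = i, OF C2[unfolded S_def] radial[unfolded S_def] _ that]
      \<open>0 < a\<close> \<open>CARD('n) = N\<close> by simp_all
  have ray: "r *\<^sub>R axis i 1 \<in> S" if "a < r" "r < b" for r
    using that \<open>0 < a\<close> by (simp add: mem_S)
  \<comment> \<open>The end points are included: this makes the boundary condition available on the axis.\<close>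
  have ray_closure: "r *\<^sub>R axis i 1 \<in> closure S" if "a \<le> r" "r \<le> b" for r
  proof -
    have "(\<lambda>r. r *\<^sub>R axis i 1) ` closure {a<..<b} \<subseteq> closure S"
      by (rule image_closure_subset)
        (use ray closure_subset[of S] in \<open>auto intro!: continuous_intros\<close>)
    moreover have "r \<in> closure {a<..<b}" using that \<open>a < b\<close> by simp
    ultimately show ?thesis by blast
  qed
  have "interior S = S" unfolding S_def by (rule interior_open[OF open_annulus])
  then have \<phi>_ends: "\<phi> a = 0" "\<phi> b = 0"
    using ray_closure[of a] ray_closure[of b] \<open>0 < a\<close> \<open>a < b\<close>
    by (auto simp: \<phi>_def frontier_def mem_S intro!: bdry)
  have cont\<phi>: "continuous_on {a..b} \<phi>"
    unfolding \<phi>_def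
    by (intro continuous_on_compose2[OF cont] continuous_intros) (auto intro: ray_closure)
  have u_eq: "u x = \<phi> (norm x)" if "x \<in> S" for x
  proof -
    have "norm x *\<^sub>R axis i 1 \<in> S" using that by (intro ray) (auto simp: mem_S)
    from radial[unfolded radial_on_def, rule_format, OF that this]
    show ?thesis by (simp add: \<phi>_def)
  qed
  have profile_eq: "radial_profile u r = \<phi> r" if r: "a < r" "r < b" for r
    unfolding radial_profile_def
  proof (rule the_equality)
    show "\<forall>x. norm x = r \<longrightarrow> u x = \<phi> r" using r u_eq by (auto simp: mem_S)
    show "c = \<phi> r" if "\<forall>x. norm x = r \<longrightarrow> u x = c" for c
      using that r \<open>0 < a\<close> by (auto simp: \<phi>_def)
  qed
  define \<kappa> where "\<kappa> = 1 / (2 - real N)"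
  have "2 - real N < 0" using \<open>N \<ge> 3\<close> by simp
  then have "\<kappa> < 0" by (simp add: \<kappa>_def)
  have inv: "(r powr (2 - real N)) powr \<kappa> = r" if "0 < r" for r
    using that \<open>2 - real N < 0\<close> by (simp add: powr_powr \<kappa>_def)
  have inv': "(s powr \<kappa>) powr (2 - real N) = s" if "0 < s" for s
    using that \<open>2 - real N < 0\<close> by (simp add: powr_powr \<kappa>_def)
  have "0 < \<alpha>" using \<open>0 < a\<close> \<open>a < b\<close> by (simp add: \<alpha>_def)
  have "\<alpha> < \<beta>"
    unfolding \<alpha>_def \<beta>_def
    using \<open>0 < a\<close> \<open>a < b\<close> \<open>2 - real N < 0\<close> by (intro powr_less_mono2_neg)
  have range: "a < s powr \<kappa>" "s powr \<kappa> < b" if "\<alpha> < s" "s < \<beta>" for s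
    using powr_less_mono2_neg[of \<kappa> s \<beta>] powr_less_mono2_neg[of \<kappa> \<alpha> s] that \<open>0 < \<alpha>\<close> \<open>\<kappa> < 0\<close>
      inv[of a] inv[of b] \<open>0 < a\<close> \<open>a < b\<close> by (auto simp: \<alpha>_def \<beta>_def)
  define v where "v = (\<lambda>s. \<phi> (s powr \<kappa>))"
  define v' where "v' = (\<lambda>s. \<phi>' (s powr \<kappa>) * (\<kappa> * s powr (\<kappa> - 1)))"
  have v_ends: "v \<alpha> = 0" "v \<beta> = 0"
    using \<phi>_ends inv[of a] inv[of b] \<open>0 < a\<close> \<open>a < b\<close> by (auto simp: v_def \<alpha>_def \<beta>_def)
  have prof: "lane_emden_profile p \<alpha> \<beta> v v'"
    unfolding lane_emden_profile_def
  proof (intro conjI ballI v_ends)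
    have closed_range: "a \<le> s powr \<kappa> \<and> s powr \<kappa> \<le> b" if s: "s \<in> {\<alpha>..\<beta>}" for s
    proof -
      consider "s = \<alpha>" | "s = \<beta>" | "\<alpha> < s" "s < \<beta>"
        using s by (auto simp: order.order_iff_strict)
      then show ?thesis
        using range[of s] inv[of a] inv[of b] \<open>0 < a\<close> \<open>a < b\<close> by cases (auto simp: \<alpha>_def \<beta>_def)
    qed
    show "continuous_on {\<alpha>..\<beta>} v"
      unfolding v_def
      by (intro continuous_on_compose2[OF cont\<phi>] continuous_intros)
        (use \<open>0 < \<alpha>\<close> closed_range in auto)
    fix s assume "s \<in> {\<alpha><..<\<beta>}"
    then have s: "\<alpha> < s" "s < \<beta>" by auto
    then have "0 < s" using \<open>0 < \<alpha>\<close> by simp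
    define r where "r = s powr \<kappa>"
    have r: "a < r" "r < b" "0 < r" using range[OF s] \<open>0 < a\<close> by (auto simp: r_def)
    show "0 < v s" using pos[OF ray] r by (simp add: v_def r_def \<phi>_def)
    have dr: "((\<lambda>s. s powr \<kappa>) has_real_derivative \<kappa> * s powr (\<kappa> - 1)) (at s)"
      using \<open>0 < s\<close> by (rule has_real_derivative_powr)
    show "(v has_real_derivative v' s) (at s)"
      unfolding v_def v'_def
      by (rule DERIV_chain2[OF _ dr]) (use lap(1) r in \<open>auto simp: r_def\<close>)
    have "((\<lambda>s. \<phi>' (s powr \<kappa>)) has_real_derivative \<phi>'' r * (\<kappa> * s powr (\<kappa> - 1))) (at s)"
      by (rule DERIV_chain2[OF _ dr]) (use lap(2) r in \<open>auto simp: r_def\<close>)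
    moreover have "((\<lambda>s. \<kappa> * s powr (\<kappa> - 1)) has_real_derivative
        \<kappa> * ((\<kappa> - 1) * s powr (\<kappa> - 1 - 1))) (at s)"
      by (intro DERIV_cmult has_real_derivative_powr \<open>0 < s\<close>)
    ultimately have dv': "(v' has_real_derivative
        \<phi>'' r * (\<kappa> * s powr (\<kappa> - 1)) * (\<kappa> * s powr (\<kappa> - 1))
          + \<kappa> * ((\<kappa> - 1) * s powr (\<kappa> - 1 - 1)) * \<phi>' r) (at s)"
      unfolding v'_def r_def by (rule DERIV_mult)
    define q where "q = s powr (\<kappa> - 1)"
    have q: "q = r ^ (N - 1)"
    proof -
      have "q = r / r powr (2 - real N)"
        using \<open>0 < s\<close> inv'[of s] by (simp add: q_def powr_diff r_def)
      also have "\<dots> = r powr (1 - (2 - real N))"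
        using r by (subst powr_diff) simp
      also have "1 - (2 - real N) = real (N - 1)" using \<open>N \<ge> 3\<close> by (simp add: of_nat_diff)
      finally show ?thesis using r by (simp add: powr_realpow)
    qed
    have q2: "r ^ (2 * (N - 1)) = q\<^sup>2" by (simp add: q mult.commute flip: power_mult)
    have "0 < q" using \<open>0 < s\<close> by (simp add: q_def)
    \<comment> \<open>With \<open>q = r\<^bsup>N-1\<^esup>\<close> all powers of \<open>s\<close> become rational in \<open>q\<close> and \<open>r\<close>.\<close>
    have s2: "s powr (\<kappa> - 1 - 1) = q\<^sup>2 / r"
      using \<open>0 < s\<close> by (simp add: q_def r_def powr_diff power2_eq_square)
    have norm_ray: "norm (r *\<^sub>R axis i 1 :: real ^ 'n) = r" using r by simp
    have pde_r: "\<phi>'' r + (real N - 1) / r * \<phi>' r = - ((real N - 2)\<^sup>2 * (\<phi> r powr p / q\<^sup>2))"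
      using pde[OF ray[OF r(1,2)]] unfolding lap(3)[OF r(1,2)] norm_ray q2 \<phi>_def by linarith
    have "\<kappa> * (real N - 2) = - 1"
      using \<open>2 - real N < 0\<close> by (simp add: \<kappa>_def field_simps)
    then have \<kappa>1: "\<kappa>\<^sup>2 * (real N - 2)\<^sup>2 = 1"
      by (metis power_mult_distrib power2_minus one_power2)
    \<comment> \<open>This identity is what removes the first-order term.\<close>
    have \<kappa>2: "\<kappa> * (\<kappa> - 1) = \<kappa>\<^sup>2 * (real N - 1)"
      using \<open>2 - real N < 0\<close> by (simp add: \<kappa>_def power2_eq_square field_simps)
    have "\<phi>'' r * (\<kappa> * q) * (\<kappa> * q) + \<kappa> * ((\<kappa> - 1) * (q\<^sup>2 / r)) * \<phi>' r
        = \<kappa>\<^sup>2 * q\<^sup>2 * \<phi>'' r + (\<kappa> * (\<kappa> - 1)) * (q\<^sup>2 / r) * \<phi>' r"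
      by (simp add: power2_eq_square)
    also have "\<dots> = \<kappa>\<^sup>2 * q\<^sup>2 * (\<phi>'' r + (real N - 1) / r * \<phi>' r)"
      unfolding \<kappa>2 by (simp add: distrib_left)
    also have "\<dots> = - ((\<kappa>\<^sup>2 * (real N - 2)\<^sup>2) * (q\<^sup>2 * (\<phi> r powr p / q\<^sup>2)))"
      unfolding pde_r by (simp only: mult_minus_right mult_ac)
    also have "\<dots> = - (\<phi> r powr p)"
      unfolding \<kappa>1 using \<open>0 < q\<close> by simp
    finally show "(v' has_real_derivative - (v s powr p)) (at s)"
      using dv' by (simp only: q_def[symmetric] s2 v_def r_def[symmetric])
  qed
  define m where "m = (\<alpha> + \<beta>) / 2"
  have m: "\<alpha> < m" "m < \<beta>" using \<open>\<alpha> < \<beta>\<close> by (auto simp: m_def)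
  have max: "\<And>s. s \<in> {\<alpha>..\<beta>} \<Longrightarrow> v s \<le> v m"
    using lane_emden_profile_max_at_midpoint(1)[OF prof \<open>1 \<le> p\<close> \<open>\<alpha> < \<beta>\<close>] by (simp add: m_def)
  define x\<^sub>0 :: "real ^ 'n" where "x\<^sub>0 = (m powr \<kappa>) *\<^sub>R axis i 1"
  have "x\<^sub>0 \<in> S" unfolding x\<^sub>0_def by (intro ray range m)
  have "u x\<^sub>0 = v m" by (simp add: x\<^sub>0_def v_def \<phi>_def)
  have "Linfty_norm S u = \<bar>u x\<^sub>0\<bar>"
  proof (rule Linfty_norm_eq_max[OF _ _ \<open>x\<^sub>0 \<in> S\<close>])
    show "open S" unfolding S_def by (rule open_annulus)
    show "continuous_on S u" by (rule continuous_on_subset[OF cont closure_subset])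
    fix x assume x: "x \<in> S"
    have nx: "a < norm x" "norm x < b" "0 < norm x" using x \<open>0 < a\<close> by (auto simp: mem_S)
    have "u x = v (norm x powr (2 - real N))"
      using u_eq[OF x] inv[of "norm x"] nx by (simp add: v_def)
    moreover have "norm x powr (2 - real N) \<in> {\<alpha>..\<beta>}"
      using powr_less_mono2_neg[of "2 - real N" a "norm x"]
        powr_less_mono2_neg[of "2 - real N" "norm x" b] nx \<open>0 < a\<close> \<open>2 - real N < 0\<close>
      by (auto simp: \<alpha>_def \<beta>_def)
    ultimately show "\<bar>u x\<bar> \<le> \<bar>u x\<^sub>0\<bar>"
      using max pos[OF x] pos[OF \<open>x\<^sub>0 \<in> S\<close>] \<open>u x\<^sub>0 = v m\<close> by auto
  qed
  then have "Linfty_norm (annulus a b) u = v m"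
    using pos[OF \<open>x\<^sub>0 \<in> S\<close>] \<open>u x\<^sub>0 = v m\<close> by (simp add: S_def)
  moreover have "radial_profile u (s powr (1 / (2 - real N))) = v s" if "\<alpha> < s" "s < \<beta>" for s
    using profile_eq range[OF that] by (simp add: v_def \<kappa>_def)
  ultimately show thesis using that prof by (simp add: m_def)
qed

section \<open>Convergence of the rescaled solutions\<close>

theorem theorem4:
  fixes N :: nat and a b :: real
    and u :: "real \<Rightarrow> real ^ 'n \<Rightarrow> real"
    and \<epsilon> :: "real \<Rightarrow> real"
  assumes "CARD('n) = N" and "N \<ge> 3" and "0 < a" and "a < b"
    and "\<And>p. p > 1 \<Longrightarrow> radial_solution N a b p (u p)"
    and "\<And>p. p > 1 \<Longrightarrow> \<epsilon> p > 0"
    and "\<And>p. p > 1 \<Longrightarrow>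
           p * (\<epsilon> p)\<^sup>2 * Linfty_norm (annulus a b) (u p) powr (p - 1) = 1"
  shows "(\<epsilon> \<longlongrightarrow> 0) at_top \<and>
    C1_loc_converges
      (\<lambda>p. rescaled N a b p (\<epsilon> p) (u p))
      (\<lambda>p. rescaled_interval N a b (\<epsilon> p))
      (\<lambda>t. ln (4 * exp (sqrt 2 * t) / (1 + exp (sqrt 2 * t))\<^sup>2))
      at_top"
proof -
  define \<alpha> where "\<alpha> = b powr (2 - real N)"
  define \<beta> where "\<beta> = a powr (2 - real N)"
  define m where "m = (\<alpha> + \<beta>) / 2"
  have "\<alpha> < \<beta>"
    unfolding \<alpha>_def \<beta>_def using assms(2-4) by (intro powr_less_mono2_neg) auto
  have "\<forall>p. \<exists>v v'. p > 1 \<longrightarrow> lane_emden_profile p \<alpha> \<beta> v v' \<and>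
      (\<forall>s. \<alpha> < s \<longrightarrow> s < \<beta> \<longrightarrow> radial_profile (u p) (s powr (1 / (2 - real N))) = v s) \<and>
      Linfty_norm (annulus a b) (u p) = v m"
  proof (intro allI)
    fix p :: real
    show "\<exists>v v'. p > 1 \<longrightarrow> lane_emden_profile p \<alpha> \<beta> v v' \<and>
      (\<forall>s. \<alpha> < s \<longrightarrow> s < \<beta> \<longrightarrow> radial_profile (u p) (s powr (1 / (2 - real N))) = v s) \<and>
      Linfty_norm (annulus a b) (u p) = v m"
    proof (cases "p > 1")
      case True
      show ?thesis
        by (rule radial_solution_lane_emden_profile[OF assms(5)[OF True] assms(1-4)])
          (use True in \<open>auto simp: \<alpha>_def \<beta>_def m_def\<close>)
    qed simp
  qed
  then obtain v v' where prof: "\<And>p. p > 1 \<Longrightarrow> lane_emden_profile p \<alpha> \<beta> (v p) (v' p)"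
    and profile: "\<And>p s. p > 1 \<Longrightarrow> \<alpha> < s \<Longrightarrow> s < \<beta> \<Longrightarrow>
          radial_profile (u p) (s powr (1 / (2 - real N))) = v p s"
    and Linfty_eq: "\<And>p. p > 1 \<Longrightarrow> Linfty_norm (annulus a b) (u p) = v p m"
    by metis
  have \<epsilon>: "p * (\<epsilon> p)\<^sup>2 * v p m powr (p - 1) = 1" if "p > 1" for p
    using assms(7)[OF that] Linfty_eq[OF that] by simp
  have \<epsilon>_bound: "\<epsilon> p \<le> (\<beta> - \<alpha>) / sqrt p" if "p > 1" for p
    using lane_emden_rescaling_bound[OF prof[OF that] _ \<open>\<alpha> < \<beta>\<close> assms(6)[OF that]] \<epsilon>[OF that] that
    by (simp add: m_def)
  have gt1: "eventually (\<lambda>p::real. p > 1) at_top" by (rule eventually_gt_at_top)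
  have \<epsilon>_lim: "(\<epsilon> \<longlongrightarrow> 0) at_top"
  proof (rule tendsto_sandwich)
    show "eventually (\<lambda>p. 0 \<le> \<epsilon> p) at_top"
      using gt1 by eventually_elim (use assms(6) in force)
    show "eventually (\<lambda>p. \<epsilon> p \<le> (\<beta> - \<alpha>) / sqrt p) at_top"
      using gt1 by eventually_elim (rule \<epsilon>_bound)
    show "((\<lambda>p. (\<beta> - \<alpha>) / sqrt p) \<longlongrightarrow> 0) at_top"
      by (intro tendsto_divide_0[OF tendsto_const] filterlim_at_top_imp_at_infinity sqrt_at_top)
  qed simp
  define W where "W = (\<lambda>p. rescaled N a b p (\<epsilon> p) (u p))"
  define W' where "W' = (\<lambda>p t. p / v p m * (\<epsilon> p * v' p (\<epsilon> p * t + m)))"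
  define I where "I = (\<lambda>p. rescaled_interval N a b (\<epsilon> p))"
  have I_eq: "I p = {- ((\<beta> - \<alpha>) / (2 * \<epsilon> p)) <..< (\<beta> - \<alpha>) / (2 * \<epsilon> p)}" for p
    by (simp add: I_def rescaled_interval_def \<alpha>_def \<beta>_def)
  have inside: "\<alpha> < \<epsilon> p * t + m" "\<epsilon> p * t + m < \<beta>" if "p > 1" "t \<in> I p" for p t
  proof -
    have "\<epsilon> p > 0" using assms(6) that by simp
    then have "- ((\<beta> - \<alpha>) / 2) < \<epsilon> p * t" "\<epsilon> p * t < (\<beta> - \<alpha>) / 2"
      using that by (auto simp: I_eq field_simps)
    then show "\<alpha> < \<epsilon> p * t + m" "\<epsilon> p * t + m < \<beta>"
      by (auto simp: m_def field_simps)
  qed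
  have W_eq: "W p t = p / v p m * (v p (\<epsilon> p * t + m) - v p m)" if "p > 1" "t \<in> I p" for p t
    using profile[OF that(1) inside[OF that]] Linfty_eq[OF that(1)]
    by (simp add: W_def rescaled_def m_def \<alpha>_def \<beta>_def add.commute)
  have chain: "((\<lambda>t. f (\<epsilon> p * t + m)) has_real_derivative \<epsilon> p * D) (at t)"
    if "(f has_real_derivative D) (at (\<epsilon> p * t + m))" for f D p t
  proof -
    have "((\<lambda>t. \<epsilon> p * t + m) has_real_derivative \<epsilon> p) (at t)"
      by (rule derivative_eq_intros refl | simp)+
    from DERIV_chain2[OF that this] show ?thesis by (simp add: mult.commute)
  qed
  have dW: "(W p has_real_derivative W' p t) (at t)" if "p > 1" "t \<in> I p" for p t
  proof (rule has_field_derivative_transform_within_open[of _ _ _ "I p"])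
    have "(v p has_real_derivative v' p (\<epsilon> p * t + m)) (at (\<epsilon> p * t + m))"
      using prof[OF that(1)] inside[OF that] by (simp add: lane_emden_profile_def)
    from DERIV_cmult[OF DERIV_diff[OF chain[OF this] DERIV_const[of "v p m"]], of "p / v p m"]
    show "((\<lambda>t. p / v p m * (v p (\<epsilon> p * t + m) - v p m)) has_real_derivative W' p t) (at t)"
      by (simp only: W'_def diff_0_right)
  qed (use that W_eq in \<open>auto simp: I_eq\<close>)
  have contW': "continuous_on (I p) (W' p)" if "p > 1" for p
  proof (rule continuous_at_imp_continuous_on, rule ballI)
    fix t assume "t \<in> I p"
    then have "(v' p has_real_derivative - (v p (\<epsilon> p * t + m) powr p)) (at (\<epsilon> p * t + m))"
      using prof[OF that] inside[OF that] by (simp add: lane_emden_profile_def)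
    from DERIV_cmult[OF DERIV_cmult[OF chain[OF this]]] show "isCont (W' p) t"
      unfolding W'_def by (rule DERIV_isCont)
  qed
  have W_C1: "W p C1_differentiable_on I p" if "p > 1" for p
    unfolding C1_differentiable_on_def
    using dW[OF that] contW'[OF that] by (auto simp: has_real_derivative_iff_has_vector_derivative)
  have U_eq: "(\<lambda>t. ln (4 * exp (sqrt 2 * t) / (1 + exp (sqrt 2 * t))\<^sup>2)) = liouville_bubble"
    by (simp add: fun_eq_iff liouville_bubble_def)
  have "continuous_on UNIV liouville_bubble'"
    using liouville_bubble'_has_derivative DERIV_isCont continuous_at_imp_continuous_on by blast
  then have U_C1: "liouville_bubble C1_differentiable_on UNIV"
    unfolding C1_differentiable_on_def
    using liouville_bubble_has_derivative by (auto simp: has_real_derivative_iff_has_vector_derivative)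
  have deriv_U: "deriv liouville_bubble = liouville_bubble'"
    using liouville_bubble_has_derivative by (auto intro: DERIV_imp_deriv)
  have on_compact: "eventually (\<lambda>p. K \<subseteq> I p) at_top \<and> uniform_limit K W liouville_bubble at_top \<and>
      uniform_limit K (\<lambda>p. deriv (W p)) (deriv liouville_bubble) at_top" if "compact K" for K
  proof -
    obtain R where "0 < R" and R: "\<And>t. t \<in> K \<Longrightarrow> \<bar>t\<bar> \<le> R"
      using compact_imp_bounded[OF \<open>compact K\<close>] by (auto simp: bounded_pos)
    \<comment> \<open>On \<open>[- R, R]\<close> both errors are at most \<open>C / p\<close>, with \<open>C\<close> depending on \<open>R\<close> alone.\<close>
    define C where "C = 2 * R ^ 4 * exp (3 * R / 2)"
    \<comment> \<open>Once \<open>\<epsilon> p\<close> is below this value, \<open>[- R, R]\<close> lies inside the rescaled interval.\<close>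
    have "0 < (\<beta> - \<alpha>) / (2 * R)" using \<open>0 < R\<close> \<open>\<alpha> < \<beta>\<close> by simp
    from order_tendstoD(2)[OF \<epsilon>_lim this]
    have large: "eventually (\<lambda>p. p > 1 \<and> R < (\<beta> - \<alpha>) / (2 * \<epsilon> p) \<and> 2 * R\<^sup>2 \<le> p) at_top"
      using gt1 eventually_ge_at_top[of "2 * R\<^sup>2"]
    proof eventually_elim
      case (elim p)
      then show ?case using assms(6)[of p] \<open>0 < R\<close> by (simp add: field_simps)
    qed
    have K_sub: "K \<subseteq> I p" if "R < (\<beta> - \<alpha>) / (2 * \<epsilon> p)" for p
      using R that by (fastforce simp: I_eq)
    have rate: "\<bar>W p t - liouville_bubble t\<bar> \<le> C / p"
        "\<bar>deriv (W p) t - deriv liouville_bubble t\<bar> \<le> C / p"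
      if p: "p > 1" "R < (\<beta> - \<alpha>) / (2 * \<epsilon> p)" "2 * R\<^sup>2 \<le> p" and "t \<in> K" for p t
    proof -
      have t: "t \<in> I p" using K_sub p \<open>t \<in> K\<close> by blast
      have d: "deriv (W p) t = W' p t" by (rule DERIV_imp_deriv[OF dW[OF p(1) t]])
      note est = rescaled_lane_emden_profile_estimate[OF prof[OF p(1)] p(1) \<open>\<alpha> < \<beta>\<close> m_def
          assms(6)[OF p(1)] \<epsilon>[OF p(1)] less_imp_le[OF \<open>0 < R\<close>] p(2,3) R[OF \<open>t \<in> K\<close>]]
      show "\<bar>W p t - liouville_bubble t\<bar> \<le> C / p"
        using est(1) by (simp add: W_eq[OF p(1) t] C_def)
      show "\<bar>deriv (W p) t - deriv liouville_bubble t\<bar> \<le> C / p"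
        using est(2) by (simp add: d deriv_U W'_def C_def)
    qed
    have small: "eventually (\<lambda>p. C / p < e) at_top" if "0 < e" for e
    proof -
      have "((\<lambda>p. C / p) \<longlongrightarrow> 0) at_top"
        by (intro tendsto_divide_0[OF tendsto_const] filterlim_at_top_imp_at_infinity filterlim_ident)
      then show ?thesis using that by (rule order_tendstoD(2))
    qed
    have "eventually (\<lambda>p. K \<subseteq> I p) at_top"
      using large by eventually_elim (use K_sub in blast)
    moreover have "uniform_limit K W liouville_bubble at_top"
    proof (rule uniform_limitI)
      fix e :: real assume "0 < e"
      from large small[OF this]
      show "eventually (\<lambda>p. \<forall>t\<in>K. dist (W p t) (liouville_bubble t) < e) at_top"
        by eventually_elim (use rate(1) in \<open>force simp: dist_real_def\<close>)
    qed
    moreover have "uniform_limit K (\<lambda>p. deriv (W p)) (deriv liouville_bubble) at_top"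
    proof (rule uniform_limitI)
      fix e :: real assume "0 < e"
      from large small[OF this]
      show "eventually (\<lambda>p. \<forall>t\<in>K. dist (deriv (W p) t) (deriv liouville_bubble t) < e) at_top"
        by eventually_elim (use rate(2) in \<open>force simp: dist_real_def\<close>)
    qed
    ultimately show ?thesis by blast
  qed
  have "eventually (\<lambda>p. W p C1_differentiable_on I p) at_top"
    using gt1 by eventually_elim (rule W_C1)
  with U_C1 on_compact have "C1_loc_converges W I liouville_bubble at_top"
    unfolding C1_loc_converges_def by blast
  then show ?thesis
    using \<epsilon>_lim unfolding U_eq W_def I_def by blast
qed

end
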